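(* There exist an absolute constant $C>0$ and an online algorithm $\mathcal{A}$ with the following property. Let $P,G\in\mathbb{R}_{>0}^{m\times n}$, let $\mathbf{w}\in\mathbb{R}_{>0}^m$ be a parameter vector whose proportional allocation has maximum load $T=\max_i\ell_i(P,G,\mathbf{w})$, and let $\tilde{\mathbf{w}}\in\mathbb{R}_{>0}^m$ be $\eta$-approximate to $\mathbf{w}$ for some $\eta\ge2$. Then $\mathcal{A}$, given $\tilde{\mathbf{w}}$ and $T$ in advance, produces a fractional assignment of the items to the agents with maximum load at most $C\,T\log\eta$.
   Context: There are $m$ agents and $n$ divisible items arriving online; $p_{i,j}$ is the weight of item $j$ for agent $i$. For $P=(p_{i,j}),G=(g_{i,j})\in\mathbb{R}_{>0}^{m\times n}$ and $\mathbf{w}\in\mathbb{R}_{>0}^m$, the proportional allocation is $x_{i,j}(G,\mathbf{w})=\dfrac{g_{i,j}w_i}{\sum_{i'=1}^m g_{i',j}w_{i'}}$ and the load of agent $i$ is $\ell_i(P,G,\mathbf{w})=\sum_{j=1}^n p_{i,j}\,x_{i,j}(G,\mathbf{w})$. A vector $\tilde{\mathbf{w}}$ is $\eta$-approximate to $\mathbf{w}$ if $\frac{\tilde w_{i'}}{\tilde w_i}\le\eta\cdot\frac{w_{i'}}{w_i}$ for all $i,i'\in[m]$. Online algorithm: when item $j$ arrives, the $j$th columns of $P$ and $G$ are revealed, and the algorithm must irrevocably choose fractions $x_{1,j},\dots,x_{m,j}\in[0,1]$ with $\sum_i x_{i,j}=1$, as a function of the advance information ($\tilde{\mathbf{w}}$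 and $T$) and of columns $1,\dots,j$ of $P$ and $G$ only (it does not know $\mathbf{w}$, $\eta$, or future items). The load of agent $i$ in the produced assignment is $\sum_j p_{i,j}x_{i,j}$. *)

theory Defs
  imports "Jordan_Normal_Form.Matrix"
begin

definition pos_vec :: "nat \<Rightarrow> real vec set" where
  "pos_vec m = {v \<in> carrier_vec m. \<forall>i<m. 0 < v $ i}"

definition pos_mat :: "nat \<Rightarrow> nat \<Rightarrow> real mat set" where
  "pos_mat m n = {A \<in> carrier_mat m n. \<forall>i<m. \<forall>j<n. 0 < A $$ (i, j)}"

text \<open>Rows are agents and columns are items, both counted from 0.\<close>

definition prop_alloc :: "real mat \<Rightarrow> real vec \<Rightarrow> real mat" where
  "prop_alloc G w = mat (dim_row G) (dim_col G)
     (\<lambda>(i, j). G $$ (i, j) * w $ i / (\<Sum>i'<dim_row G. G $$ (i', j) * w $ i'))"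

definition load :: "real mat \<Rightarrow> real mat \<Rightarrow> nat \<Rightarrow> real" where
  "load P X i = (\<Sum>j<dim_col P. P $$ (i, j) * X $$ (i, j))"

definition max_load :: "real mat \<Rightarrow> real mat \<Rightarrow> real" where
  "max_load P X = Max (load P X ` {..<dim_row P})"

definition eta_approximate :: "real \<Rightarrow> real vec \<Rightarrow> real vec \<Rightarrow> bool" where
  "eta_approximate \<eta> wt w \<longleftrightarrow> dim_vec wt = dim_vec w \<and>
     (\<forall>i<dim_vec w. \<forall>i'<dim_vec w. wt $ i' / wt $ i \<le> \<eta> * (w $ i' / w $ i))"

definition simplex_vec :: "nat \<Rightarrow> real vec set" where
  "simplex_vec m = {x \<in> carrier_vec m. (\<forall>i<m. 0 \<le> x $ i \<and> x $ i \<le> 1) \<and> (\<Sum>i<m. x $ i) = 1}"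

definition fractional_assignment :: "nat \<Rightarrow> nat \<Rightarrow> real mat \<Rightarrow> bool" where
  "fractional_assignment m n X \<longleftrightarrow> X \<in> carrier_mat m n \<and> (\<forall>j<n. col X j \<in> simplex_vec m)"

text \<open>
  An online algorithm maps the advance information (predicted weights and target load) and the
  nonempty list of items revealed so far, in order of arrival, to the fractions of the item that
  arrived last. An item is the pair of its columns in P and G. The type alone excludes any
  dependence on the true weights, the approximation factor, the number of items or future items;
  the number of agents is the dimension of the predicted weights.
\<close>

type_synonym item = "real vec \<times> real vec"
type_synonym algorithm = "real vec \<Rightarrow> real \<Rightarrow> item list \<Rightarrow> real vec"

text \<open>
  The fractions must be legal on every input, even when the advance information is inaccurate.
\<close>

definition online_algorithm :: "algorithm \<Rightarrow> bool" where
  "online_algorithm A \<longleftrightarrow>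
     (\<forall>m wt T items. 0 < m \<longrightarrow> wt \<in> pos_vec m \<longrightarrow> items \<noteq> [] \<longrightarrow>
        set items \<subseteq> pos_vec m \<times> pos_vec m \<longrightarrow> A wt T items \<in> simplex_vec m)"

definition revealed :: "real mat \<Rightarrow> real mat \<Rightarrow> nat \<Rightarrow> item list" where
  "revealed P G j = map (\<lambda>k. (col P k, col G k)) [0..<Suc j]"

definition online_assignment ::
  "algorithm \<Rightarrow> real vec \<Rightarrow> real \<Rightarrow> real mat \<Rightarrow> real mat \<Rightarrow> real mat" where
  "online_assignment A wt T P G =
     mat (dim_row P) (dim_col P) (\<lambda>(i, j). A wt T (revealed P G j) $ i)"

end

theory Submission
  imports Defs
begin

text \<open>
  The algorithm scales the predicted weight of agent i down by 2 to the power k i, where k is the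
  pointwise least vector of levels for which the load of every agent i, current item included, is
  at most 2 T (k i + 1). Put r i = wt i / w i, and let K i be the number of halvings that bring r i
  into the interval (r/2, r], where r is the minimum of the r i; then K i is at most log 2 eta + 1.
  Under the levels K every agent gets at most twice its share under w. By minimality k is at most K,
  and an agent that has reached level K i gets no more than under K, so that it receives at most
  2 T in total from then on. Hence K remains admissible and all loads stay below 2 T (K i + 1).
\<close>

section \<open>The halving algorithm, item by item\<close>

definition share :: "nat \<Rightarrow> (nat \<Rightarrow> real) \<Rightarrow> (nat \<Rightarrow> real) \<Rightarrow> nat \<Rightarrow> real" where
  "share m g v i = g i * v i / (\<Sum>i'<m. g i' * v i')"

definition scaled :: "(nat \<Rightarrow> real) \<Rightarrow> (nat \<Rightarrow> nat) \<Rightarrow> nat \<Rightarrow> real" where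
  "scaled v k i = v i / 2 ^ k i"

text \<open>\<open>L\<close> holds the loads before the current item, whose columns are
  \<open>p\<close> and \<open>g\<close>. Each further level raises the budget of an agent by
  \<open>2 * T\<close>.\<close>

definition admissible ::
  "nat \<Rightarrow> real \<Rightarrow> (nat \<Rightarrow> real) \<Rightarrow> (nat \<Rightarrow> real) \<Rightarrow> (nat \<Rightarrow> real) \<Rightarrow> (nat \<Rightarrow> real) \<Rightarrow> (nat \<Rightarrow> nat) \<Rightarrow> bool"
  where "admissible m T v L p g k \<longleftrightarrow>
    (\<forall>i<m. L i + p i * share m g (scaled v k) i \<le> 2 * T * (real (k i) + 1))"

text \<open>
  With a wrong T no levels need be admissible; the infimum is then an arbitrary value, and the
  shares are still a legal choice.
\<close>

definition least_levels ::
  "nat \<Rightarrow> real \<Rightarrow> (nat \<Rightarrow> real) \<Rightarrow> (nat \<Rightarrow> real) \<Rightarrow> (nat \<Rightarrow> real) \<Rightarrow> (nat \<Rightarrow> real) \<Rightarrow> nat \<Rightarrow> nat"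
  where "least_levels m T v L p g i = (INF k \<in> Collect (admissible m T v L p g). k i)"

definition choice :: "real vec \<Rightarrow> real \<Rightarrow> (nat \<Rightarrow> real) \<Rightarrow> item \<Rightarrow> nat \<Rightarrow> real" where
  "choice wt T L it = share (dim_vec wt) (($) (snd it))
     (scaled (($) wt) (least_levels (dim_vec wt) T (($) wt) L (($) (fst it)) (($) (snd it))))"

text \<open>The past items are listed with the most recent one first.\<close>

fun past_load :: "real vec \<Rightarrow> real \<Rightarrow> item list \<Rightarrow> nat \<Rightarrow> real" where
  "past_load wt T [] i = 0"
| "past_load wt T (it # past) i =
     past_load wt T past i + fst it $ i * choice wt T (past_load wt T past) it i"

text \<open>An \<open>algorithm\<close> carries no state, so the loads are recomputed by replaying
  all earlier choices. Reversal puts the current item at the head and the past behind it.\<close>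

definition halving_algorithm :: algorithm where
  "halving_algorithm wt T items =
     vec (dim_vec wt) (choice wt T (past_load wt T (tl (rev items))) (hd (rev items)))"

section \<open>Comparison of shares under two weightings\<close>

lemma share_sum_pos:
  fixes m :: nat
  assumes "\<And>i. i < m \<Longrightarrow> 0 < g i" "\<And>i. i < m \<Longrightarrow> 0 < v i" "0 < m"
  shows "0 < (\<Sum>i<m. g i * v i :: real)"
  using assms by (intro sum_pos) auto

lemma share_nonneg:
  assumes "\<And>i. i < m \<Longrightarrow> 0 < g i" "\<And>i. i < m \<Longrightarrow> 0 < v i" "i < m"
  shows "0 \<le> share m g v i"
  unfolding share_def using assms
  by (intro divide_nonneg_nonneg sum_nonneg mult_nonneg_nonneg) (auto simp: less_imp_le)

lemma sum_share:
  assumes "\<And>i. i < m \<Longrightarrow> 0 < g i" "\<And>i. i < m \<Longrightarrow> 0 < v i" "0 < m"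
  shows "(\<Sum>i<m. share m g v i) = 1"
  using share_sum_pos[of m g v] assms
  unfolding share_def by (simp flip: sum_divide_distrib)

lemma share_le_one:
  assumes "\<And>i. i < m \<Longrightarrow> 0 < g i" "\<And>i. i < m \<Longrightarrow> 0 < v i" "i < m"
  shows "share m g v i \<le> 1"
proof -
  have "share m g v i \<le> (\<Sum>i<m. share m g v i)"
    using assms by (intro member_le_sum share_nonneg) auto
  also have "\<dots> = 1" using assms by (intro sum_share) auto
  finally show ?thesis .
qed

text \<open>Passing from \<open>u\<close> to \<open>v\<close> multiplies the numerator by at most
  \<open>a\<close> and the denominator by at least \<open>b\<close>. The numerator involves agent
  \<open>i\<close> alone, the denominator all agents.\<close>

lemma share_compare:
  assumes g: "\<And>i. i < m \<Longrightarrow> 0 < g i" and u: "\<And>i. i < m \<Longrightarrow> 0 < u i"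
    and i: "i < m" and "0 < b" and up: "v i \<le> a * u i"
    and low: "\<And>i'. i' < m \<Longrightarrow> b * u i' \<le> v i'"
  shows "share m g v i \<le> a / b * share m g u i"
proof -
  let ?S = "\<Sum>i'<m. g i' * u i'"
  have S: "0 < ?S" using g u i by (intro share_sum_pos) auto
  have "0 < b * u i" using u i \<open>0 < b\<close> by simp
  then have au: "0 \<le> a * u i" using low[OF i] up by linarith
  have "b * ?S = (\<Sum>i'<m. g i' * (b * u i'))"
    by (simp add: sum_distrib_left algebra_simps)
  also have "\<dots> \<le> (\<Sum>i'<m. g i' * v i')"
    using g low by (intro sum_mono mult_left_mono) (auto simp: less_imp_le)
  finally have "b * ?S \<le> (\<Sum>i'<m. g i' * v i')" .
  moreover have "g i * v i \<le> g i * (a * u i)"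
    using g[OF i] up by simp
  ultimately have "share m g v i \<le> g i * (a * u i) / (b * ?S)"
    unfolding share_def using g[OF i] au S \<open>0 < b\<close>
    by (intro frac_le) auto
  then show ?thesis by (simp add: share_def algebra_simps)
qed

lemma scaled_pos: "0 < v i \<Longrightarrow> 0 < scaled v k i"
  by (simp add: scaled_def)

text \<open>Lower levels of the other agents raise their weights and hence the denominator, while
  the numerator of \<open>i\<close> stays fixed: \<open>share_compare\<close> with
  \<open>a = b = 1\<close>.\<close>

lemma share_scaled_mono:
  assumes "\<And>i. i < m \<Longrightarrow> 0 < g i" "\<And>i. i < m \<Longrightarrow> 0 < v i" "i < m"
    and "k i = k' i" "\<And>i'. i' < m \<Longrightarrow> k i' \<le> k' i'"
  shows "share m g (scaled v k) i \<le> share m g (scaled v k') i"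
proof -
  have "share m g (scaled v k) i \<le> 1 / 1 * share m g (scaled v k') i"
    using assms
    by (intro share_compare scaled_pos)
       (auto simp: scaled_def less_imp_le intro!: divide_left_mono power_increasing)
  then show ?thesis by simp
qed

section \<open>Least admissible levels\<close>

lemma least_levels_le:
  "admissible m T v L p g k \<Longrightarrow> least_levels m T v L p g i \<le> k i"
  unfolding least_levels_def by (rule cINF_lower) auto

text \<open>At each \<open>i\<close> the infimum is attained by some admissible \<open>k\<close>.
  Passing from \<open>k\<close> to the infimum keeps the level of \<open>i\<close> and raises no
  other level, so the share of \<open>i\<close> does not grow. \<open>K\<close> witnesses that there
  are admissible levels at all.\<close>

lemma admissible_least_levels:
  assumes g: "\<And>i. i < m \<Longrightarrow> 0 < g i" and v: "\<And>i. i < m \<Longrightarrow> 0 < v i"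
    and p: "\<And>i. i < m \<Longrightarrow> 0 < p i" and adm: "admissible m T v L p g K"
  shows "admissible m T v L p g (least_levels m T v L p g)"
  unfolding admissible_def
proof (intro allI impI)
  fix i assume i: "i < m"
  let ?k = "least_levels m T v L p g"
  have "?k i \<in> (\<lambda>k. k i) ` Collect (admissible m T v L p g)"
    unfolding least_levels_def using adm by (intro Inf_nat_def1) auto
  then obtain k where k: "admissible m T v L p g k" and eq: "?k i = k i"
    by auto
  have "share m g (scaled v ?k) i \<le> share m g (scaled v k) i"
    using g v i eq by (intro share_scaled_mono least_levels_le k) auto
  then have "L i + p i * share m g (scaled v ?k) i \<le> L i + p i * share m g (scaled v k) i"
    using p[OF i] by simp
  also have "\<dots> \<le> 2 * T * (real (k i) + 1)"
    using k i unfolding admissible_def by blast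
  finally show "L i + p i * share m g (scaled v ?k) i \<le> 2 * T * (real (?k i) + 1)"
    unfolding eq .
qed

text \<open>One step of the load invariant. \<open>S i\<close> stands for the load of agent
  \<open>i\<close> so far under the true weights, \<open>y i\<close> for its share of the current
  item under them.\<close>

lemma least_levels_step:
  assumes g: "\<And>i. i < m \<Longrightarrow> 0 < g i" and v: "\<And>i. i < m \<Longrightarrow> 0 < v i"
    and p: "\<And>i. i < m \<Longrightarrow> 0 < p i" and i: "i < m" and T: "0 \<le> T"
    and K: "\<And>i. i < m \<Longrightarrow> share m g (scaled v K) i \<le> 2 * y i"
    and L: "\<And>i. i < m \<Longrightarrow> L i \<le> 2 * T * real (K i) + 2 * S i"
    and S: "\<And>i. i < m \<Longrightarrow> 0 \<le> S i" "\<And>i. i < m \<Longrightarrow> S i + p i * y i \<le> T"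
  shows "L i + p i * share m g (scaled v (least_levels m T v L p g)) i
           \<le> 2 * T * real (K i) + 2 * (S i + p i * y i)"
proof -
  let ?k = "least_levels m T v L p g"
  have bound: "L i + p i * share m g (scaled v K) i \<le> 2 * T * real (K i) + 2 * (S i + p i * y i)"
    if "i < m" for i
  proof -
    have "p i * share m g (scaled v K) i \<le> p i * (2 * y i)"
      using K[OF that] p[OF that] by (intro mult_left_mono) auto
    with L[OF that] show ?thesis by (simp add: algebra_simps)
  qed
  \<comment> \<open>Since the true load stays below \<open>T\<close>, the invariant bound fits into
    the budget of level \<open>K i\<close>.\<close>
  have "2 * T * real (K i) + 2 * (S i + p i * y i) \<le> 2 * T * (real (K i) + 1)" if "i < m" for i
    using S(2)[OF that] by (simp add: algebra_simps)
  with bound have adm: "admissible m T v L p g K"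
    unfolding admissible_def by (meson order_trans)
  have le: "?k i \<le> K i" for i by (rule least_levels_le[OF adm])
  show ?thesis
  proof (cases "?k i = K i")
    \<comment> \<open>At level \<open>K i\<close> the share is charged to the one under
      \<open>K\<close>, which is larger because no other agent exceeds its level in
      \<open>K\<close>.\<close>
    case True
    then have "share m g (scaled v ?k) i \<le> share m g (scaled v K) i"
      using g v i le by (intro share_scaled_mono) auto
    then have "p i * share m g (scaled v ?k) i \<le> p i * share m g (scaled v K) i"
      using p[OF i] by simp
    with bound[OF i] show ?thesis by linarith
  next
    case False
    \<comment> \<open>Levels are integers, so an agent below \<open>K i\<close> has a whole budget
      step of slack, and admissibility alone suffices.\<close>
    with le[of i] have "real (?k i) + 1 \<le> real (K i)" by linarith
    have "L i + p i * share m g (scaled v ?k) i \<le> 2 * T * (real (?k i) + 1)"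
      using admissible_least_levels[OF g v p adm] i unfolding admissible_def by blast
    also have "\<dots> \<le> 2 * T * real (K i)"
      using T \<open>real (?k i) + 1 \<le> real (K i)\<close> by (intro mult_left_mono) auto
    finally have "L i + p i * share m g (scaled v ?k) i \<le> 2 * T * real (K i)" .
    moreover have "0 \<le> y i"
    proof -
      have "0 \<le> share m g (scaled v K) i"
        using g v i by (intro share_nonneg scaled_pos)
      with K[OF i] show ?thesis by linarith
    qed
    then have "0 \<le> p i * y i" using p[OF i] by simp
    ultimately show ?thesis using S(1)[OF i] by simp
  qed
qed

section \<open>Levels that undo the prediction error\<close>

text \<open>Rounding \<open>log 2 (R / r)\<close> up costs at most one extra halving, so
  \<open>R / 2 ^ k\<close> lands at most a factor 2 below \<open>r\<close>.\<close>

lemma halving_count: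
  fixes r R \<eta> :: real
  assumes "0 < r" "r \<le> R" "R \<le> \<eta> * r"
  shows "\<exists>k::nat. r / 2 \<le> R / 2 ^ k \<and> R / 2 ^ k \<le> r \<and> real k \<le> log 2 \<eta> + 1"
proof -
  define z where "z = log 2 (R / r)"
  define k where "k = nat \<lceil>z\<rceil>"
  have ratio: "1 \<le> R / r" "R / r \<le> \<eta>" using assms by (auto simp: field_simps)
  \<comment> \<open>Nonnegativity of \<open>z\<close> ensures that \<open>nat\<close> does not
    truncate the ceiling.\<close>
  then have z: "0 \<le> z" "z \<le> log 2 \<eta>" by (auto simp: z_def)
  have k: "z \<le> real k" "real k \<le> z + 1" using z by (auto simp: k_def)
  have pow: "2 powr z = R / r" using ratio by (simp add: z_def)
  have "2 powr z \<le> 2 powr real k" "2 powr real k \<le> 2 powr (z + 1)" using k by auto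
  then have "R / r \<le> 2 ^ k" "2 ^ k \<le> 2 * (R / r)"
    by (simp_all add: pow powr_add powr_realpow mult.commute)
  then show ?thesis using k z assms by (intro exI[of _ k]) (auto simp: field_simps)
qed

text \<open>After the halvings all ratios of scaled to true weight lie between \<open>r / 2\<close>
  and \<open>r\<close>, which costs a factor 2 in the shares. \<open>K\<close> is fixed before
  \<open>g\<close>, so the same levels serve every item.\<close>

lemma near_proportional_levels:
  assumes m: "0 < m" and v: "\<And>i. i < m \<Longrightarrow> 0 < v i" and w: "\<And>i. i < m \<Longrightarrow> 0 < w i"
    and approx: "\<And>i i'. i < m \<Longrightarrow> i' < m \<Longrightarrow> v i' / v i \<le> \<eta> * (w i' / w i)"
  obtains K :: "nat \<Rightarrow> nat" where
    "\<And>g i. (\<And>i. i < m \<Longrightarrow> 0 < g i) \<Longrightarrow> i < m \<Longrightarrow> share m g (scaled v K) i \<le> 2 * share m g w i"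
    "\<And>i. i < m \<Longrightarrow> real (K i) \<le> log 2 \<eta> + 1"
proof -
  define R where "R i = v i / w i" for i
  define r where "r = Min (R ` {..<m})"
  have "r \<in> R ` {..<m}" unfolding r_def using m by (intro Min_in) auto
  then obtain i0 where i0: "i0 < m" "r = R i0" by auto
  have r: "0 < r" using i0 v w by (simp add: R_def)
  have "\<exists>k::nat. r / 2 \<le> R i / 2 ^ k \<and> R i / 2 ^ k \<le> r \<and> real k \<le> log 2 \<eta> + 1" if i: "i < m" for i
  proof (rule halving_count[OF r])
    show "r \<le> R i" unfolding r_def using i by (intro Min_le) auto
    \<comment> \<open>The approximation is used for the pair of \<open>i\<close> and the agent
      \<open>i0\<close> attaining the minimum.\<close>
    show "R i \<le> \<eta> * r"
      using approx[OF i0(1) i] v[OF i] v[OF i0(1)] w[OF i] w[OF i0(1)]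
      by (simp add: i0(2) R_def field_simps)
  qed
  then obtain K where K: "\<And>i. i < m \<Longrightarrow> r / 2 \<le> R i / 2 ^ K i \<and> R i / 2 ^ K i \<le> r
      \<and> real (K i) \<le> log 2 \<eta> + 1"
    by metis
  have eq: "scaled v K i = R i / 2 ^ K i * w i" if "i < m" for i
    using w[OF that] by (simp add: scaled_def R_def)
  show thesis
  proof
    fix g :: "nat \<Rightarrow> real" and i assume g: "\<And>i. i < m \<Longrightarrow> 0 < g i" and i: "i < m"
    have "share m g (scaled v K) i \<le> r / (r / 2) * share m g w i"
    proof (rule share_compare[OF g w i])
      show "scaled v K i \<le> r * w i"
        unfolding eq[OF i] using K[OF i] w[OF i] by (intro mult_right_mono) auto
      show "r / 2 * w i' \<le> scaled v K i'" if "i' < m" for i'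
        unfolding eq[OF that] using K[OF that] w[OF that] by (intro mult_right_mono) auto
    qed (use r in auto)
    then show "share m g (scaled v K) i \<le> 2 * share m g w i" using r by simp
  next
    fix i assume "i < m"
    then show "real (K i) \<le> log 2 \<eta> + 1" using K by blast
  qed
qed

section \<open>Legality of the choices and the resulting matrix\<close>

text \<open>Scaled weights are positive for every vector of levels, so their shares are legal
  fractions even when \<open>T\<close> is wrong.\<close>

lemma online_halving_algorithm: "online_algorithm halving_algorithm"
  unfolding online_algorithm_def
proof (intro allI impI)
  fix m wt T and items :: "item list"
  assume m: "0 < m" and wt: "wt \<in> pos_vec m" and ne: "items \<noteq> []"
    and items: "set items \<subseteq> pos_vec m \<times> pos_vec m"
  define it where "it = hd (rev items)"
  have "it \<in> set items" unfolding it_def using ne by (simp add: hd_rev)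
  then have g: "\<And>i. i < m \<Longrightarrow> 0 < snd it $ i" using items by (auto simp: pos_vec_def)
  have dim: "dim_vec wt = m" and v: "\<And>i. i < m \<Longrightarrow> 0 < wt $ i"
    using wt by (auto simp: pos_vec_def)
  show "halving_algorithm wt T items \<in> simplex_vec m"
    unfolding halving_algorithm_def simplex_vec_def choice_def dim it_def[symmetric]
    using g v m by (auto intro!: share_nonneg share_le_one sum_share scaled_pos)
qed

lemma rev_revealed:
  "rev (revealed P G j) = (col P j, col G j) # rev (map (\<lambda>k. (col P k, col G k)) [0..<j])"
  by (simp add: revealed_def)

lemma col_pos_vec: "A \<in> pos_mat m n \<Longrightarrow> j < n \<Longrightarrow> col A j \<in> pos_vec m"
  by (auto simp: pos_mat_def pos_vec_def)

lemma fractional_online_assignment: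
  assumes A: "online_algorithm A" and m: "0 < m" and wt: "wt \<in> pos_vec m"
    and P: "P \<in> pos_mat m n" and G: "G \<in> pos_mat m n"
  shows "fractional_assignment m n (online_assignment A wt T P G)"
proof -
  have dims: "dim_row P = m" "dim_col P = n" "dim_row G = m" "dim_col G = n"
    using P G by (auto simp: pos_mat_def)
  have "col (online_assignment A wt T P G) j \<in> simplex_vec m" if j: "j < n" for j
  proof -
    have "col P k \<in> pos_vec m" "col G k \<in> pos_vec m" if "k < Suc j" for k
      using col_pos_vec[OF P, of k] col_pos_vec[OF G, of k] that j by simp_all
    then have "set (revealed P G j) \<subseteq> pos_vec m \<times> pos_vec m"
      unfolding revealed_def by fastforce
    moreover have "revealed P G j \<noteq> []" by (simp add: revealed_def)
    ultimately have "A wt T (revealed P G j) \<in> simplex_vec m"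
      using A m wt unfolding online_algorithm_def by blast
    moreover from this have "col (online_assignment A wt T P G) j = A wt T (revealed P G j)"
      using j by (intro eq_vecI) (auto simp: online_assignment_def dims simplex_vec_def)
    ultimately show ?thesis by simp
  qed
  then show ?thesis by (auto simp: fractional_assignment_def online_assignment_def dims)
qed

text \<open>The reversed list at time \<open>j\<close> has the reversed first \<open>j\<close> items
  as its tail, so the replay reproduces the entries of the assignment and the simulated load is the
  real one.\<close>

lemma past_load_revealed:
  assumes "i < dim_row P" "dim_vec wt = dim_row P" "l \<le> dim_col P"
  shows "past_load wt T (rev (map (\<lambda>k. (col P k, col G k)) [0..<l])) i =
     (\<Sum>j<l. P $$ (i, j) * online_assignment halving_algorithm wt T P G $$ (i, j))"
  using assms(3)
  by (induction l)
     (use assms(1,2) in \<open>auto simp: online_assignment_def halving_algorithm_def rev_revealed\<close>)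

lemma load_online_halving:
  assumes "i < dim_row P" "dim_vec wt = dim_row P"
  shows "load P (online_assignment halving_algorithm wt T P G) i =
     past_load wt T (rev (map (\<lambda>k. (col P k, col G k)) [0..<dim_col P])) i"
  using assms by (simp add: past_load_revealed load_def)

section \<open>The load bound\<close>

text \<open>Induction on the number of items by \<open>least_levels_step\<close>, with the prefix
  loads under \<open>w\<close> as \<open>S\<close>. \<open>K\<close> occurs in the analysis only;
  the algorithm never sees it.\<close>

lemma past_load_bound:
  assumes P: "P \<in> pos_mat m n" and G: "G \<in> pos_mat m n" and wt: "wt \<in> pos_vec m"
    and w: "w \<in> pos_vec m"
    and T: "\<And>i. i < m \<Longrightarrow> load P (prop_alloc G w) i \<le> T"
    and K: "\<And>g i. (\<And>i. i < m \<Longrightarrow> 0 < g i) \<Longrightarrow> i < m \<Longrightarrow>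
      share m g (scaled (($) wt) K) i \<le> 2 * share m g (($) w) i"
    and i: "i < m" and l: "l \<le> n"
  shows "past_load wt T (rev (map (\<lambda>k. (col P k, col G k)) [0..<l])) i
    \<le> 2 * T * real (K i) + 2 * (\<Sum>j<l. P $$ (i, j) * prop_alloc G w $$ (i, j))"
proof -
  have dims: "dim_row P = m" "dim_col P = n" "dim_row G = m" "dim_col G = n" "dim_vec wt = m"
    using P G wt by (auto simp: pos_mat_def pos_vec_def)
  have p: "0 < P $$ (i, j)" if "i < m" "j < n" for i j using P that by (auto simp: pos_mat_def)
  have g: "0 < col G j $ i" if "i < m" "j < n" for i j
    using G that dims by (auto simp: pos_mat_def)
  have v: "0 < wt $ i" "0 < w $ i" if "i < m" for i using wt w that by (auto simp: pos_vec_def)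
  have alloc: "prop_alloc G w $$ (i, j) = share m (($) (col G j)) (($) w) i" if "i < m" "j < n" for i j
    using that dims by (auto simp: prop_alloc_def share_def)
  define S where "S l i = (\<Sum>j<l. P $$ (i, j) * prop_alloc G w $$ (i, j))" for l i
  have nonneg: "0 \<le> P $$ (i, j) * prop_alloc G w $$ (i, j)" if "i < m" "j < n" for i j
    unfolding alloc[OF that] using p[OF that] g v that
    by (intro mult_nonneg_nonneg share_nonneg) (auto simp: less_imp_le)
  have S0: "0 \<le> S l i" if "i < m" "l \<le> n" for l i
    unfolding S_def using nonneg that by (intro sum_nonneg) auto
  have ST: "S l i \<le> T" if "i < m" "l \<le> n" for l i
  proof -
    have "S l i \<le> load P (prop_alloc G w) i"
      unfolding S_def load_def dims using that nonneg by (intro sum_mono2) auto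
    with T[OF that(1)] show ?thesis by simp
  qed
  \<comment> \<open>The empty prefix has load 0, which is at most \<open>T\<close>.\<close>
  have T0: "0 \<le> T" using S0[OF i, of 0] ST[OF i, of 0] by linarith
  have "past_load wt T (rev (map (\<lambda>k. (col P k, col G k)) [0..<l])) i \<le> 2 * T * real (K i) + 2 * S l i"
    using l i
  \<comment> \<open>The levels for the next item depend on the loads of all agents, so the invariant
    must hold for every \<open>i\<close> at once.\<close>
  proof (induction l arbitrary: i)
    case 0
    then show ?case using T0 by (simp add: S_def)
  next
    case (Suc l)
    then have ln: "l < n" by simp
    have S_Suc: "S (Suc l) i = S l i + col P l $ i * share m (($) (col G l)) (($) w) i" if "i < m" for i
      unfolding S_def using alloc[OF that ln] dims that ln by simp
    have "past_load wt T (rev (map (\<lambda>k. (col P k, col G k)) [0..<l])) i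
        + col P l $ i * share m (($) (col G l)) (scaled (($) wt) (least_levels m T (($) wt)
            (past_load wt T (rev (map (\<lambda>k. (col P k, col G k)) [0..<l])))
            (($) (col P l)) (($) (col G l)))) i
      \<le> 2 * T * real (K i) + 2 * (S l i + col P l $ i * share m (($) (col G l)) (($) w) i)"
    proof (rule least_levels_step)
      show "S l i + col P l $ i * share m (($) (col G l)) (($) w) i \<le> T" if "i < m" for i
        using ST[OF that, of "Suc l"] S_Suc[OF that] Suc.prems by simp
    qed (use Suc g p v T0 S0 K ln dims in auto)
    then show ?case using S_Suc[OF Suc.prems(2)] by (simp add: choice_def dims)
  qed
  then show ?thesis unfolding S_def .
qed

theorem theorem5p4:
  "\<exists>C::real>0. \<exists>A. online_algorithm A \<and>
     (\<forall>m n P G w wt T \<eta>.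
        0 < m \<longrightarrow> P \<in> pos_mat m n \<longrightarrow> G \<in> pos_mat m n \<longrightarrow>
        w \<in> pos_vec m \<longrightarrow> wt \<in> pos_vec m \<longrightarrow>
        T = max_load P (prop_alloc G w) \<longrightarrow> 2 \<le> \<eta> \<longrightarrow> eta_approximate \<eta> wt w \<longrightarrow>
        fractional_assignment m n (online_assignment A wt T P G) \<and>
        max_load P (online_assignment A wt T P G) \<le> C * T * ln \<eta>)"
\<comment> \<open>As \<open>log 2 \<eta> \<ge> 1\<close>, the bound \<open>2 * T * (K i + 1)\<close>
  is at most \<open>2 * T * (log 2 \<eta> + 2) \<le> 6 * T * log 2 \<eta>\<close>; the factor
  \<open>1 / ln 2\<close> converts the base.\<close>
proof (intro exI[of _ "6 / ln 2"] conjI exI[of _ halving_algorithm] allI impI)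
  show "(0::real) < 6 / ln 2" by simp
  show "online_algorithm halving_algorithm" by (rule online_halving_algorithm)
  fix m n P G w wt T and \<eta> :: real
  assume m: "0 < m" and P: "P \<in> pos_mat m n" and G: "G \<in> pos_mat m n"
    and w: "w \<in> pos_vec m" and wt: "wt \<in> pos_vec m"
    and T: "T = max_load P (prop_alloc G w)" and \<eta>: "2 \<le> \<eta>" and approx: "eta_approximate \<eta> wt w"
  let ?X = "online_assignment halving_algorithm wt T P G"
  show "fractional_assignment m n ?X"
    by (rule fractional_online_assignment[OF online_halving_algorithm m wt P G])
  have dims: "dim_row P = m" "dim_col P = n" "dim_vec wt = m" "dim_vec w = m"
    using P w wt by (auto simp: pos_mat_def pos_vec_def)
  have pos: "0 < wt $ i" "0 < w $ i" if "i < m" for i using wt w that by (auto simp: pos_vec_def)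
  obtain K :: "nat \<Rightarrow> nat" where
    K: "\<And>g i. (\<And>i. i < m \<Longrightarrow> 0 < g i) \<Longrightarrow> i < m \<Longrightarrow>
      share m g (scaled (($) wt) K) i \<le> 2 * share m g (($) w) i"
    and Klog: "\<And>i. i < m \<Longrightarrow> real (K i) \<le> log 2 \<eta> + 1"
    using near_proportional_levels[of m "($) wt" "($) w" \<eta>] m pos approx
    by (auto simp: eta_approximate_def dims)
  have LT: "load P (prop_alloc G w) i \<le> T" if "i < m" for i
    unfolding T max_load_def dims using that by (intro Max_ge) auto
  have log1: "1 \<le> log 2 \<eta>" using \<eta> by simp
  have "load P ?X i \<le> 6 / ln 2 * T * ln \<eta>" if i: "i < m" for i
  proof -
    have "load P ?X i \<le> 2 * T * real (K i) + 2 * load P (prop_alloc G w) i"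
      using past_load_bound[OF P G wt w LT K i order_refl] i dims
      by (simp add: load_online_halving) (simp add: load_def dims)
    also have "\<dots> \<le> 2 * T * real (K i) + 2 * T" using LT[OF i] by simp
    also have "\<dots> = 2 * T * (real (K i) + 1)" by (simp add: algebra_simps)
    also have "\<dots> \<le> 2 * T * (3 * log 2 \<eta>)"
    proof (rule mult_left_mono)
      \<comment> \<open>A nonnegative load below \<open>T\<close> supplies the sign of
        \<open>T\<close>.\<close>
      have "0 \<le> load P (prop_alloc G w) i"
        using P G w pos i unfolding load_def pos_mat_def prop_alloc_def
        by (auto intro!: sum_nonneg mult_nonneg_nonneg divide_nonneg_nonneg simp: less_imp_le)
      with LT[OF i] show "0 \<le> 2 * T" by simp
    qed (use Klog[OF i] log1 in linarith)
    also have "\<dots> = 6 / ln 2 * T * ln \<eta>" by (simp add: log_def)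
    finally show ?thesis .
  qed
  then show "max_load P ?X \<le> 6 / ln 2 * T * ln \<eta>"
    unfolding max_load_def dims using m by (subst Max_le_iff) auto
qed

end
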